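(* Let $X^0=\{x_i^0\}_{i=1}^N\subset\mathbb{R}^n$ be a point cloud, $z\in\mathbb{R}^n$, $R^0=\max_{i=1,\dots,N}|x_i^0-z|$, and assume that $(X(t))_{0\le t<T}$, $X(t)=(x_1(t),\dots,x_N(t))$, satisfies $X(0)=X^0$ and $$\frac{\mathrm{d}}{\mathrm{d}t}x_i(t)=H_\varepsilon^\Pi(x_i(t),V(t)),\qquad V(t)=\sum_{i=1}^Nm_i(X(t))\,\delta_{(x_i(t),P_i(X(t)))},\qquad i=1,\dots,N.$$ Then $R(t)=\max_{i=1,\dots,N}|x_i(t)-z|$ fulfills, for $0\le t<T$, $$R(t)\le\sqrt{(R^0)^2-2d\int_0^tc(s)\,\mathrm{d}s},$$ where $$c(t)=\min\left\{\frac{\Pi_{ij}(t)(x_i(t)-x_j(t))\cdot(x_i(t)-z)}{|x_i(t)-x_j(t)|^2}\ :\ i,j\in\{1,\dots,N\},\ |x_i(t)-z|=R(t),\ 0<|x_i(t)-x_j(t)|<\varepsilon\right\}.$$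
   Context: $1\le d\le n$ are integers, $\varepsilon>0$, $T\in(0,+\infty]$. $\rho,\xi\in C^\infty(\mathbb{R})$ are fixed nonnegative even functions, compactly supported in $[-1,1]$, positive on $(0,1)$, $\rho$ nonincreasing on $[0,1]$, with $n\,\xi(s)=-s\,\rho'(s)$ for $s\in(-1,1)$. Masses $m_i(t)=m_i(X(t))>0$ and directions $P_i(t)=P_i(X(t))$ ($d$-dimensional linear subspaces of $\mathbb{R}^n$) are computed from the positions by a prescribed rule; $\Pi_P$ is the orthogonal projector onto $P$, and $\Pi_{ij}(t)$ is one fixed choice among $$\Pi_{P_j},\quad-2\Pi_{P_j^\perp},\quad2\,\mathrm{Id},\quad\Pi_{P_i^\perp}\circ\Pi_{P_j},\quad-2\Pi_{P_i^\perp}\circ\Pi_{P_j^\perp},\quad2\Pi_{P_i^\perp}$$ with $P_i=P_i(t)$, $P_j=P_j(t)$. For the point cloud varifold $V(t)$ (weighted sum of Dirac masses in $\mathbb{R}^n\times G_{d,n}$, $G_{d,n}$ the Grassmannian of $d$-planes), $$H_\varepsilon^\Pi(x_i(t),V(t))=-\frac dn\,\frac1\varepsilon\,\frac{\sum_{j=1}^Nm_j(t)\,\rho'\!\left(\frac{|x_j(t)-x_i(t)|}{\varepsilon}\right)\Pi_{ij}(t)\!\left(\frac{x_j(t)-x_i(t)}{|x_j(t)-x_i(t)|}\right)}{\sum_{j=1}^Nm_j(t)\,\xi\!\left(\frac{|x_j(t)-x_i(t)|}{\varepsilon}\right)},$$ terms with $x_j(t)=x_i(t)$ in the numerator being zero.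 The right-hand side is understood to be well defined (positive denominators), and $c$ is understood to be integrable on $[0,t]$ so that the integral makes sense. *)

theory Defs
  imports "HOL-Analysis.Analysis"
begin

definition smooth :: "(real \<Rightarrow> real) \<Rightarrow> bool" where
  "smooth f \<longleftrightarrow> (\<forall>k. (deriv ^^ k) f differentiable_on UNIV)"

definition profile :: "(real \<Rightarrow> real) \<Rightarrow> bool" where
  "profile f \<longleftrightarrow> smooth f \<and> (\<forall>s. 0 \<le> f s) \<and> (\<forall>s. f (- s) = f s)
     \<and> closure {s. f s \<noteq> 0} \<subseteq> {-1..1} \<and> (\<forall>s\<in>{0<..<1}. 0 < f s)"

text \<open>For a subspace \<open>P\<close>, the point \<open>p\<close> exists and is unique.\<close>

definition orth_proj :: "(real ^ 'n) set \<Rightarrow> real ^ 'n \<Rightarrow> real ^ 'n" where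
  "orth_proj P v = (THE p. p \<in> P \<and> v - p \<in> orthogonal_comp P)"

definition grassmannian :: "nat \<Rightarrow> (real ^ 'n) set set" where
  "grassmannian d = {P. subspace P \<and> dim P = d}"

datatype proj_kind =
    Tan | Minus_Two_Nor | Two_Id | Nor_Tan | Minus_Two_Nor_Nor | Two_Nor

text \<open>The first plane is that of the point \<open>i\<close> where the curvature is evaluated, the second
  that of the summation point \<open>j\<close>; so \<open>pair_proj \<kappa> P\<^sub>i P\<^sub>j\<close> is \<open>\<Pi>\<^sub>i\<^sub>j\<close>.\<close>

fun pair_proj :: "proj_kind \<Rightarrow> (real ^ 'n) set \<Rightarrow> (real ^ 'n) set \<Rightarrow> real ^ 'n \<Rightarrow> real ^ 'n" where
  "pair_proj Tan P Q v = orth_proj Q v"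
| "pair_proj Minus_Two_Nor P Q v = - 2 *\<^sub>R orth_proj (orthogonal_comp Q) v"
| "pair_proj Two_Id P Q v = 2 *\<^sub>R v"
| "pair_proj Nor_Tan P Q v = orth_proj (orthogonal_comp P) (orth_proj Q v)"
| "pair_proj Minus_Two_Nor_Nor P Q v =
     - 2 *\<^sub>R orth_proj (orthogonal_comp P) (orth_proj (orthogonal_comp Q) v)"
| "pair_proj Two_Nor P Q v = 2 *\<^sub>R orth_proj (orthogonal_comp P) v"

text \<open>A point cloud varifold, i.e. the measure given by the sum over \<open>i\<close> of \<open>mass i\<close> times the
  Dirac mass at \<open>(pos i, dir i)\<close>, is recorded by its labelled atoms: when atoms share a position,
  the measure and the position alone do not determine the plane \<open>P\<^sub>i\<close> occurring in \<open>\<Pi>\<^sub>i\<^sub>j\<close>.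
  The curvature is correspondingly evaluated at a label \<open>i\<close> instead of at the position of \<open>i\<close>.\<close>

record ('n, 'N) point_cloud_varifold =
  mass :: "'N \<Rightarrow> real"
  pos :: "'N \<Rightarrow> real ^ 'n"
  dir :: "'N \<Rightarrow> (real ^ 'n) set"

definition curv_denom ::
    "(real \<Rightarrow> real) \<Rightarrow> real \<Rightarrow> ('n::finite, 'N::finite) point_cloud_varifold \<Rightarrow> 'N \<Rightarrow> real" where
  "curv_denom \<xi> \<epsilon> V i = (\<Sum>j\<in>UNIV. mass V j * \<xi> (norm (pos V j - pos V i) / \<epsilon>))"

definition approx_curv ::
    "nat \<Rightarrow> (real \<Rightarrow> real) \<Rightarrow> (real \<Rightarrow> real) \<Rightarrow> proj_kind \<Rightarrow> real
      \<Rightarrow> ('n::finite, 'N::finite) point_cloud_varifold \<Rightarrow> 'N \<Rightarrow> real ^ 'n" where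
  "approx_curv d \<rho> \<xi> \<kappa> \<epsilon> V i =
     (- (real d / real CARD('n)) * (1 / \<epsilon>) / curv_denom \<xi> \<epsilon> V i) *\<^sub>R
     (\<Sum>j\<in>UNIV. if pos V j = pos V i then 0 else
        (mass V j * deriv \<rho> (norm (pos V j - pos V i) / \<epsilon>)) *\<^sub>R
        pair_proj \<kappa> (dir V i) (dir V j)
          ((pos V j - pos V i) /\<^sub>R norm (pos V j - pos V i)))"

definition cloud_radius :: "real ^ 'n \<Rightarrow> ('N::finite \<Rightarrow> real ^ 'n) \<Rightarrow> real" where
  "cloud_radius z x = (MAX i. norm (x i - z))"

text \<open>\<open>Min\<close> is unspecified on the empty set, but the set below is nonempty as soon as
  \<open>curv_denom \<xi> \<epsilon> V i > 0\<close> for all \<open>i\<close>: a profile \<open>\<xi>\<close> vanishes outside \<open>{-1<..<1}\<close>, and at \<open>0\<close>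
  by \<open>n \<xi>(s) = - s \<rho>'(s)\<close>, so each point has a neighbour at a distance in \<open>{0<..<\<epsilon>}\<close>.\<close>

definition contraction_rate ::
    "proj_kind \<Rightarrow> real \<Rightarrow> real ^ 'n \<Rightarrow> ('n::finite, 'N::finite) point_cloud_varifold \<Rightarrow> real" where
  "contraction_rate \<kappa> \<epsilon> z V =
     Min {(pair_proj \<kappa> (dir V i) (dir V j) (pos V i - pos V j) \<bullet> (pos V i - z))
            / (norm (pos V i - pos V j))\<^sup>2 | i j.
          norm (pos V i - z) = cloud_radius z (pos V) \<and>
          0 < norm (pos V i - pos V j) \<and> norm (pos V i - pos V j) < \<epsilon>}"

end

theory Submission
  imports Defs
begin

text \<open>
  For a point \<open>i\<close> with \<open>|x\<^sub>i - z| = R\<close>, the relation \<open>n \<xi>(s) = - s \<rho>'(s)\<close> turns \<open>H \<bullet> (x\<^sub>i - z)\<close> into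
  \<open>-d\<close> times the average, with weights \<open>m\<^sub>j \<xi>(|x\<^sub>i - x\<^sub>j| / \<epsilon>)\<close>, of the quotients whose minimum is
  \<open>c\<close>, so that \<open>|x\<^sub>i - z|\<^sup>2\<close> has derivative at most \<open>-2 d c\<close>. As masses and planes need not depend
  regularly on the positions, these derivatives need not be integrable and \<open>R\<^sup>2\<close> need not be
  absolutely continuous; but the bound holds at every time, and comparing \<open>R\<^sup>2\<close> with
  Henstock-Kurzweil sums of \<open>-2 d c\<close> needs no more than that.
\<close>

section \<open>Increments and pointwise derivative bounds\<close>

text \<open>On a sufficiently fine tagged division the increments of \<open>f\<close> telescope to
  \<open>f b - f a\<close>, while the local bounds add up to a Riemann sum of \<open>g\<close> plus
  a small error. The bound is imposed on intervals straddling the tag, with a radius depending on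
  the tag, so it applies to maxima that fail to be differentiable and to any gauge integrable
  \<open>g\<close>.\<close>

lemma increment_le_integral:
  fixes f g :: "real \<Rightarrow> real"
  assumes "a \<le> b" and g: "g integrable_on {a..b}"
    and straddle: "\<And>x e. x \<in> {a..b} \<Longrightarrow> 0 < e \<Longrightarrow>
      \<exists>\<delta>>0. \<forall>u\<in>{a..x}. \<forall>v\<in>{x..b}. x - u < \<delta> \<longrightarrow> v - x < \<delta> \<longrightarrow> f v - f u \<le> (g x + e) * (v - u)"
  shows "f b - f a \<le> integral {a..b} g"
proof (rule field_le_epsilon)
  fix e :: real
  assume "0 < e"
  \<comment> \<open>The local errors cost \<open>e' * (b - a)\<close> in total and the Riemann sum
    costs another \<open>e'\<close>. The summand 1 keeps the denominator positive when
    \<open>a = b\<close>.\<close>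
  define e' where "e' = e / (b - a + 1)"
  have "0 < e'" "e' * (b - a + 1) = e"
    using \<open>0 < e\<close> \<open>a \<le> b\<close> by (simp_all add: e'_def)
  then have e': "0 < e'" "e' * (b - a) + e' = e"
    by (simp_all add: distrib_left)
  \<comment> \<open>A gauge must be defined on the whole line, so the membership condition moves
    inside and any positive radius serves outside the interval.\<close>
  have "\<exists>\<delta>>0. x \<in> {a..b} \<longrightarrow> (\<forall>u\<in>{a..x}. \<forall>v\<in>{x..b}. x - u < \<delta> \<longrightarrow> v - x < \<delta> \<longrightarrow>
      f v - f u \<le> (g x + e') * (v - u))" for x
    using straddle[OF _ e'(1), of x] by (cases "x \<in> {a..b}") (auto intro: exI[of _ 1])
  then obtain \<delta> where \<delta>: "\<And>x. 0 < \<delta> x"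
    "\<And>x u v. \<lbrakk>x \<in> {a..b}; u \<in> {a..x}; v \<in> {x..b}; x - u < \<delta> x; v - x < \<delta> x\<rbrakk> \<Longrightarrow>
      f v - f u \<le> (g x + e') * (v - u)"
    by metis
  obtain \<gamma> where \<gamma>: "gauge \<gamma>"
    "\<And>p. \<lbrakk>p tagged_division_of {a..b}; \<gamma> fine p\<rbrakk> \<Longrightarrow>
      norm ((\<Sum>(x, K)\<in>p. measure lborel K *\<^sub>R g x) - integral {a..b} g) < e'"
    using integrable_integral[OF g] e'(1) unfolding has_integral_real by meson
  \<comment> \<open>The factor \<open>\<gamma>\<close> controls the Riemann sum; the ball keeps both
    ends of each piece within \<open>\<delta> x\<close> of its tag.\<close>
  have "gauge (\<lambda>x. \<gamma> x \<inter> ball x (\<delta> x))"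
    using \<gamma>(1) \<delta>(1) by (simp add: gauge_Int gauge_ball_dependent)
  then obtain p where p: "p tagged_division_of {a..b}" "(\<lambda>x. \<gamma> x \<inter> ball x (\<delta> x)) fine p"
    by (rule fine_division_exists_real)
  have "f b - f a = (\<Sum>(x, K)\<in>p. f (Sup K) - f (Inf K))"
    using additive_tagged_division_1[OF \<open>a \<le> b\<close> p(1), of f] by simp
  also have "\<dots> \<le> (\<Sum>(x, K)\<in>p. measure lborel K *\<^sub>R g x + e' * (Sup K - Inf K))"
  proof (rule sum_mono, clarify)
    fix x K
    assume xK: "(x, K) \<in> p"
    then obtain u v where K: "K = {u..v}" "x \<in> K" "K \<subseteq> {a..b}"
      using tagged_division_ofD(2-4)[OF p(1)] by (metis box_real(2))
    then have "u \<le> x" "x \<le> v" "a \<le> u" "v \<le> b"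
      by auto
    moreover have "K \<subseteq> ball x (\<delta> x)"
      using p(2) xK by (auto simp: fine_def)
    then have "x - u < \<delta> x" "v - x < \<delta> x"
      using K(1) \<open>u \<le> x\<close> \<open>x \<le> v\<close> by (force simp: subset_iff dist_real_def)+
    ultimately have "f v - f u \<le> (g x + e') * (v - u)"
      by (intro \<delta>(2)) auto
    then show "f (Sup K) - f (Inf K) \<le> measure lborel K *\<^sub>R g x + e' * (Sup K - Inf K)"
      using K(1) \<open>u \<le> x\<close> \<open>x \<le> v\<close> by (simp add: algebra_simps)
  qed
  also have "\<dots> = (\<Sum>(x, K)\<in>p. measure lborel K *\<^sub>R g x) + e' * (\<Sum>(x, K)\<in>p. Sup K - Inf K)"
    by (simp add: case_prod_unfold sum.distrib sum_distrib_left)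
  also have "(\<Sum>(x, K)\<in>p. Sup K - Inf K) = b - a"
    using additive_tagged_division_1[OF \<open>a \<le> b\<close> p(1), of "\<lambda>x. x"] by simp
  also have "(\<Sum>(x, K)\<in>p. measure lborel K *\<^sub>R g x) < integral {a..b} g + e'"
  proof -
    have "\<gamma> fine p"
      using p(2) by (auto simp: fine_def)
    from \<gamma>(2)[OF p(1) this] show ?thesis
      by (simp add: abs_less_iff)
  qed
  finally show "f b - f a \<le> integral {a..b} g + e"
    using e'(2) by linarith
qed

text \<open>To the left of \<open>x\<close> any single maximal function at \<open>x\<close> does; to the right, the functions that
  are not maximal at \<open>x\<close> have to be excluded first.\<close>

lemma Max_increment_le:
  fixes h :: "'i::finite \<Rightarrow> real \<Rightarrow> real"
  assumes x: "x \<in> {a..b}" and e: "0 < e"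
    and der: "\<And>i. (h i has_real_derivative h' i) (at x within {a..b})"
    and le: "\<And>i. h i x = (MAX i. h i x) \<Longrightarrow> h' i \<le> c"
  shows "\<exists>\<delta>>0. \<forall>u\<in>{a..x}. \<forall>v\<in>{x..b}. x - u < \<delta> \<longrightarrow> v - x < \<delta> \<longrightarrow>
    (MAX i. h i v) - (MAX i. h i u) \<le> (c + e) * (v - u)"
proof -
  let ?M = "\<lambda>y. MAX i. h i y"
  have M_ge: "h i y \<le> ?M y" for i y
    by simp
  have M_attained: "\<exists>i. h i y = ?M y" for y
  proof -
    have "?M y \<in> range (\<lambda>i. h i y)"
      by (intro Max_in) auto
    then obtain i where "?M y = h i y"
      by (rule rangeE)
    then show ?thesis
      by (metis (no_types))
  qed
  obtain j where j: "h j x = ?M x"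
    using M_attained by blast
  have "\<exists>\<delta>>0. \<forall>y\<in>{a..b}. \<bar>y - x\<bar> < \<delta> \<longrightarrow> \<bar>h i y - h i x - h' i * (y - x)\<bar> \<le> e * \<bar>y - x\<bar>" for i
    using der[of i] e unfolding has_field_derivative_def has_derivative_within_alt by simp
  then obtain \<delta>1 where \<delta>1: "\<And>i. 0 < \<delta>1 i"
    "\<And>i y. \<lbrakk>y \<in> {a..b}; \<bar>y - x\<bar> < \<delta>1 i\<rbrakk> \<Longrightarrow> \<bar>h i y - h i x - h' i * (y - x)\<bar> \<le> e * \<bar>y - x\<bar>"
    by metis
  have "\<exists>\<delta>>0. \<forall>y\<in>{a..b}. \<bar>y - x\<bar> < \<delta> \<longrightarrow> h i x < ?M x \<longrightarrow> h i y < h j y" for i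
  proof (cases "h i x < ?M x")
    case True
    have "continuous (at x within {a..b}) (\<lambda>y. h j y - h i y)"
      using der by (intro continuous_diff) (auto intro: DERIV_continuous)
    moreover have "0 < h j x - h i x"
      using True j by simp
    \<comment> \<open>The tolerance is the gap at \<open>x\<close> itself, so
      \<open>h j - h i\<close> stays positive nearby.\<close>
    ultimately obtain \<delta> where "0 < \<delta>"
      "\<forall>y\<in>{a..b}. dist y x < \<delta> \<longrightarrow> dist (h j y - h i y) (h j x - h i x) < h j x - h i x"
      unfolding continuous_within_eps_delta by meson
    then show ?thesis
      by (intro exI[of _ \<delta>]) (fastforce simp: dist_real_def)
  qed (auto intro: exI[of _ 1])
  then obtain \<delta>2 where \<delta>2: "\<And>i. 0 < \<delta>2 i"
    "\<And>i y. \<lbrakk>y \<in> {a..b}; \<bar>y - x\<bar> < \<delta>2 i; h i x < ?M x\<rbrakk> \<Longrightarrow> h i y < h j y"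
    by metis
  define \<delta> where "\<delta> = (MIN i. min (\<delta>1 i) (\<delta>2 i))"
  have \<delta>: "0 < \<delta>" "\<And>i. \<delta> \<le> \<delta>1 i" "\<And>i. \<delta> \<le> \<delta>2 i"
  proof -
    show "0 < \<delta>"
      using \<delta>1(1) \<delta>2(1) by (simp add: \<delta>_def)
    have "\<delta> \<le> min (\<delta>1 i) (\<delta>2 i)" for i
      unfolding \<delta>_def by (intro Min_le) auto
    then show "\<delta> \<le> \<delta>1 i" "\<delta> \<le> \<delta>2 i" for i
      by simp_all
  qed
  have left: "?M x - ?M u \<le> (c + e) * (x - u)" if "u \<in> {a..x}" "x - u < \<delta>" for u
  proof -
    have "\<bar>h j u - h j x - h' j * (u - x)\<bar> \<le> e * \<bar>u - x\<bar>"
      using that x \<delta>(2)[of j] by (intro \<delta>1(2)) auto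
    then have "h j x - h j u \<le> h' j * (x - u) + e * (x - u)"
      using that by (simp add: algebra_simps abs_le_iff)
    moreover have "h' j * (x - u) \<le> c * (x - u)"
      using le[OF j] that by (intro mult_right_mono) auto
    ultimately show ?thesis
      using M_ge[of j u] j unfolding distrib_right by linarith
  qed
  have right: "?M v - ?M x \<le> (c + e) * (v - x)" if "v \<in> {x..b}" "v - x < \<delta>" for v
  proof -
    \<comment> \<open>This index may change with \<open>v\<close>, but by the choice of
      \<open>\<delta>2\<close> it is also maximal at \<open>x\<close>, so \<open>c\<close> bounds
      its derivative.\<close>
    obtain i where i: "h i v = ?M v"
      using M_attained by blast
    have v: "v \<in> {a..b}" "\<bar>v - x\<bar> < \<delta>1 i" "\<bar>v - x\<bar> < \<delta>2 i"
      using that x \<delta>(2)[of i] \<delta>(3)[of i] by auto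
    have "\<not> h i x < ?M x"
      using \<delta>2(2)[OF v(1,3)] M_ge[of j v] i by fastforce
    then have "h i x = ?M x"
      using M_ge[of i x] by linarith
    moreover have "h' i * (v - x) \<le> c * (v - x)"
      using le[OF \<open>h i x = ?M x\<close>] that by (intro mult_right_mono) auto
    ultimately show ?thesis
      using that i \<delta>1(2)[OF v(1,2)] by (simp add: algebra_simps abs_le_iff)
  qed
  show ?thesis
  proof (intro exI[of _ \<delta>] conjI ballI impI)
    fix u v
    assume "u \<in> {a..x}" "v \<in> {x..b}" "x - u < \<delta>" "v - x < \<delta>"
    then show "?M v - ?M u \<le> (c + e) * (v - u)"
      using left[of u] right[of v] by (simp add: algebra_simps)
  qed (fact \<delta>(1))
qed

section \<open>The approximate curvature at an extremal point\<close>

lemma orth_proj_eqI: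
  assumes "subspace P" "p \<in> P" "v - p \<in> orthogonal_comp P"
  shows "orth_proj P v = p"
  unfolding orth_proj_def
proof (rule the_equality)
  fix q
  assume q: "q \<in> P \<and> v - q \<in> orthogonal_comp P"
  have "(v - p) - (v - q) \<in> orthogonal_comp P"
    using assms(3) q by (metis subspace_diff subspace_orthogonal_comp)
  moreover have "q - p \<in> P"
    using assms q by (intro subspace_diff) auto
  ultimately have "q - p \<in> P \<inter> orthogonal_comp P"
    by simp
  then show "q = p"
    using orthogonal_Int_0[OF assms(1)] by simp
qed (use assms in auto)

lemma orth_proj_scaleR:
  assumes "subspace P"
  shows "orth_proj P (a *\<^sub>R v) = a *\<^sub>R orth_proj P v"
proof -
  obtain p q where "p \<in> span P" "\<And>w. w \<in> span P \<Longrightarrow> orthogonal q w" "v = p + q"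
    using orthogonal_subspace_decomp_exists by blast
  then have p: "p \<in> P" "v - p \<in> orthogonal_comp P"
    using assms by (auto simp: orthogonal_comp_def orthogonal_commute span_base)
      (metis span_eq_iff)
  have "orth_proj P (a *\<^sub>R v) = a *\<^sub>R p"
  proof (rule orth_proj_eqI[OF assms])
    show "a *\<^sub>R p \<in> P"
      using assms p by (simp add: subspace_scale)
    have "a *\<^sub>R (v - p) \<in> orthogonal_comp P"
      using p by (simp add: subspace_scale subspace_orthogonal_comp)
    then show "a *\<^sub>R v - a *\<^sub>R p \<in> orthogonal_comp P"
      by (simp add: scaleR_diff_right)
  qed
  then show ?thesis
    using orth_proj_eqI[OF assms p] by simp
qed

text \<open>Every admissible choice is built from scalings and orthogonal projectors. This lets the
  unit vectors in the curvature be exchanged for the differences in the contraction rate, sign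
  included.\<close>

lemma pair_proj_scaleR:
  assumes "subspace P" "subspace Q"
  shows "pair_proj \<kappa> P Q (a *\<^sub>R v) = a *\<^sub>R pair_proj \<kappa> P Q v"
  using assms by (cases \<kappa>) (simp_all add: orth_proj_scaleR subspace_orthogonal_comp)

section \<open>Profiles at and beyond radius one\<close>

lemma smooth_differentiable_on:
  assumes "smooth f"
  shows "f differentiable_on UNIV"
  using assms[unfolded smooth_def, THEN spec, of 0] by simp

text \<open>By continuity the set of nonzeros is open, hence lies in the interior of
  \<open>{-1..1}\<close>; this settles the endpoint \<open>s = 1\<close> as well.\<close>

lemma profile_eq_0:
  assumes "profile f" "1 \<le> s"
  shows "f s = 0"
proof -
  have "continuous_on UNIV f"
    using assms by (simp add: profile_def smooth_differentiable_on differentiable_imp_continuous_on)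
  then have "open {s. f s \<noteq> 0}"
    by (intro open_Collect_neq) auto
  moreover have "{s. f s \<noteq> 0} \<subseteq> {-1..1}"
    using assms(1) unfolding profile_def by (meson closure_subset order_trans)
  ultimately have "{s. f s \<noteq> 0} \<subseteq> interior {-1..1}"
    by (intro interior_maximal)
  then show ?thesis
    using assms(2) by (force simp: interior_atLeastAtMost_real)
qed

text \<open>A nonnegative function has a minimum wherever it vanishes. This covers
  \<open>s = 1\<close>, where the relation between the two profiles is not assumed.\<close>

lemma profile_deriv_eq_0:
  assumes "profile f" "1 \<le> s"
  shows "deriv f s = 0"
proof -
  have "f differentiable at s"
    using assms(1) smooth_differentiable_on[of f] by (simp add: profile_def differentiable_on_def)
  then have "DERIV f s :> deriv f s"
    using DERIV_deriv_iff_real_differentiable by blast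
  then show ?thesis
    using assms profile_eq_0[OF assms] by (intro DERIV_local_min[where d = 1]) (auto simp: profile_def)
qed

text \<open>Each summand of the numerator, paired with \<open>pos V i - z\<close>, is at least
  \<open>n * \<epsilon> * c\<close> times the matching summand of the denominator. The prefactor of
  the curvature is nonpositive, so the lower bound on the sum becomes an upper bound.\<close>

lemma approx_curv_inner_le:
  fixes V :: "('n::finite, 'N::finite) point_cloud_varifold"
  assumes eps: "0 < \<epsilon>"
    and profiles: "profile \<rho>" "profile \<xi>"
    and rho_xi: "\<And>s. s \<in> {-1<..<1} \<Longrightarrow> real CARD('n) * \<xi> s = - s * deriv \<rho> s"
    and mass: "\<And>j. 0 \<le> mass V j"
    and dir: "\<And>j. subspace (dir V j)"
    and denom: "0 < curv_denom \<xi> \<epsilon> V i"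
    and i: "norm (pos V i - z) = cloud_radius z (pos V)"
  shows "approx_curv d \<rho> \<xi> \<kappa> \<epsilon> V i \<bullet> (pos V i - z) \<le> - real d * contraction_rate \<kappa> \<epsilon> z V"
proof -
  define w where "w = pos V i - z"
  define c where "c = contraction_rate \<kappa> \<epsilon> z V"
  define r where "r j = norm (pos V j - pos V i)" for j
  define n where "n = real CARD('n)"
  define D where "D = curv_denom \<xi> \<epsilon> V i"
  define F where "F j = (if pos V j = pos V i then 0 else
      (mass V j * deriv \<rho> (r j / \<epsilon>)) *\<^sub>R
      pair_proj \<kappa> (dir V i) (dir V j) ((pos V j - pos V i) /\<^sub>R r j))" for j
  have n: "0 < n"
    by (simp add: n_def)
  have F: "n * \<epsilon> * c * (mass V j * \<xi> (r j / \<epsilon>)) \<le> F j \<bullet> w" for j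
  proof -
    consider "r j = 0" | "\<epsilon> \<le> r j" | "0 < r j" "r j < \<epsilon>"
      unfolding r_def by (metis linorder_not_less norm_ge_zero order_le_less)
    then show ?thesis
    proof cases
      case 1
      \<comment> \<open>Coincident points, \<open>i\<close> itself included, drop out of both sums:
        by convention from the numerator, by \<open>\<xi> 0 = 0\<close> from the
        denominator.\<close>
      have "\<xi> 0 = 0"
        using rho_xi[of 0] by simp
      with 1 show ?thesis
        by (simp add: F_def r_def)
    next
      case 2
      then have "\<xi> (r j / \<epsilon>) = 0" "deriv \<rho> (r j / \<epsilon>) = 0"
        using eps by (simp_all add: profile_eq_0[OF profiles(2)] profile_deriv_eq_0[OF profiles(1)])
      then show ?thesis
        by (simp add: F_def)
    next
      case 3
      define q where "q = (pair_proj \<kappa> (dir V i) (dir V j) (pos V i - pos V j) \<bullet> w)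
          / (norm (pos V i - pos V j))\<^sup>2"
      have r: "norm (pos V i - pos V j) = r j"
        by (simp add: r_def norm_minus_commute)
      \<comment> \<open>The maximality of \<open>i\<close> puts this quotient among those whose
        minimum is \<open>c\<close>.\<close>
      have "c \<le> q"
        unfolding c_def contraction_rate_def
      proof (rule Min_le)
        show "finite {(pair_proj \<kappa> (dir V i) (dir V j) (pos V i - pos V j) \<bullet> (pos V i - z))
            / (norm (pos V i - pos V j))\<^sup>2 | i j.
          norm (pos V i - z) = cloud_radius z (pos V) \<and>
          0 < norm (pos V i - pos V j) \<and> norm (pos V i - pos V j) < \<epsilon>}"
          by (rule finite_subset[of _ "range (\<lambda>(i, j).
            (pair_proj \<kappa> (dir V i) (dir V j) (pos V i - pos V j) \<bullet> (pos V i - z))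
            / (norm (pos V i - pos V j))\<^sup>2)"]) auto
        show "q \<in> {(pair_proj \<kappa> (dir V i) (dir V j) (pos V i - pos V j) \<bullet> (pos V i - z))
            / (norm (pos V i - pos V j))\<^sup>2 | i j.
          norm (pos V i - z) = cloud_radius z (pos V) \<and>
          0 < norm (pos V i - pos V j) \<and> norm (pos V i - pos V j) < \<epsilon>}"
          using i 3 r unfolding q_def w_def by (intro CollectI exI[of _ i] exI[of _ j]) auto
      qed
      \<comment> \<open>Reversing the difference gives the minus sign, normalising it gives
        \<open>1 / r j\<close>, and \<open>(r j)\<^sup>2\<close> undoes the denominator of
        \<open>q\<close>.\<close>
      have "F j \<bullet> w = mass V j * deriv \<rho> (r j / \<epsilon>) * ((- 1 / r j) * (q * (r j)\<^sup>2))"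
      proof -
        have "(pos V j - pos V i) /\<^sub>R r j = (- 1 / r j) *\<^sub>R (pos V i - pos V j)"
          by (simp add: divide_inverse algebra_simps)
        moreover have "pos V j \<noteq> pos V i"
          using 3 by (auto simp: r_def)
        ultimately have "F j \<bullet> w = mass V j * deriv \<rho> (r j / \<epsilon>)
            * ((- 1 / r j) * (pair_proj \<kappa> (dir V i) (dir V j) (pos V i - pos V j) \<bullet> w))"
          by (simp only: F_def if_False pair_proj_scaleR[OF dir dir] inner_scaleR_left)
        moreover have "pair_proj \<kappa> (dir V i) (dir V j) (pos V i - pos V j) \<bullet> w = q * (r j)\<^sup>2"
          using 3 by (simp add: q_def r)
        ultimately show ?thesis
          by simp
      qed
      also have "\<dots> = \<epsilon> * mass V j * q * (- (r j / \<epsilon>) * deriv \<rho> (r j / \<epsilon>))"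
        using 3 eps by (simp add: field_simps power2_eq_square)
      also have "- (r j / \<epsilon>) * deriv \<rho> (r j / \<epsilon>) = n * \<xi> (r j / \<epsilon>)"
        unfolding n_def using 3 eps by (subst rho_xi) (auto simp: field_simps)
      finally have "F j \<bullet> w = n * \<epsilon> * (mass V j * \<xi> (r j / \<epsilon>)) * q"
        by simp
      moreover have "0 \<le> n * \<epsilon> * (mass V j * \<xi> (r j / \<epsilon>))"
        using n eps mass profiles(2) by (simp add: profile_def)
      ultimately have "n * \<epsilon> * (mass V j * \<xi> (r j / \<epsilon>)) * c \<le> F j \<bullet> w"
        using mult_left_mono[OF \<open>c \<le> q\<close>] by metis
      then show ?thesis
        by (simp add: mult_ac)
    qed
  qed
  have "n * \<epsilon> * c * D = (\<Sum>j\<in>UNIV. n * \<epsilon> * c * (mass V j * \<xi> (r j / \<epsilon>)))"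
    by (simp add: D_def curv_denom_def r_def sum_distrib_left)
  also have "\<dots> \<le> (\<Sum>j\<in>UNIV. F j) \<bullet> w"
    unfolding inner_sum_left by (intro sum_mono F)
  finally have sum: "n * \<epsilon> * c * D \<le> (\<Sum>j\<in>UNIV. F j) \<bullet> w" .
  have "approx_curv d \<rho> \<xi> \<kappa> \<epsilon> V i = (- (real d / n) * (1 / \<epsilon>) / D) *\<^sub>R (\<Sum>j\<in>UNIV. F j)"
    by (simp only: approx_curv_def F_def r_def n_def D_def)
  then have "approx_curv d \<rho> \<xi> \<kappa> \<epsilon> V i \<bullet> w = - ((real d / (n * \<epsilon> * D)) * ((\<Sum>j\<in>UNIV. F j) \<bullet> w))"
    by simp
  \<comment> \<open>Positivity of \<open>D\<close> allows the division, after which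
    \<open>n * \<epsilon> * D\<close> cancels.\<close>
  also have "\<dots> \<le> - ((real d / (n * \<epsilon> * D)) * (n * \<epsilon> * c * D))"
    using n eps denom sum by (intro le_imp_neg_le mult_left_mono) (auto simp: D_def)
  also have "\<dots> = - real d * c"
    using n eps denom by (simp add: D_def)
  finally show ?thesis
    by (simp add: w_def c_def)
qed

section \<open>Evolution of the squared radius\<close>

lemma cloud_radius_square:
  "(cloud_radius z x)\<^sup>2 = (MAX i. (norm (x i - z))\<^sup>2)"
proof (rule Max_eqI[symmetric])
  have "cloud_radius z x \<in> range (\<lambda>i. norm (x i - z))"
    unfolding cloud_radius_def by (intro Max_in) auto
  then show "(cloud_radius z x)\<^sup>2 \<in> range (\<lambda>i. (norm (x i - z))\<^sup>2)"
    by auto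
  show "y \<le> (cloud_radius z x)\<^sup>2" if "y \<in> range (\<lambda>i. (norm (x i - z))\<^sup>2)" for y
    using that by (auto simp: cloud_radius_def intro!: power_mono)
qed auto

lemma cloud_radius_nonneg: "0 \<le> cloud_radius z x"
  unfolding cloud_radius_def by (subst Max_ge_iff) auto

theorem proposition5p2:
  fixes d :: nat and \<epsilon> :: real and T :: ereal
    and \<rho> \<xi> :: "real \<Rightarrow> real" and \<kappa> :: proj_kind
    and m :: "real ^ 'n ^ 'N \<Rightarrow> 'N \<Rightarrow> real"
    and P :: "real ^ 'n ^ 'N \<Rightarrow> 'N \<Rightarrow> (real ^ 'n) set"
    and X :: "real \<Rightarrow> real ^ 'n ^ 'N" and X0 :: "real ^ 'n ^ 'N"
    and V :: "real \<Rightarrow> ('n::finite, 'N::finite) point_cloud_varifold"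
    and z :: "real ^ 'n" and t :: real
  assumes d: "1 \<le> d" "d \<le> CARD('n)"
    and eps: "0 < \<epsilon>"
    and T: "0 < T"
    and profiles: "profile \<rho>" "profile \<xi>"
    and rho_antimono: "antimono_on {0..1} \<rho>"
    and rho_xi: "\<And>s. s \<in> {-1<..<1} \<Longrightarrow> real CARD('n) * \<xi> s = - s * deriv \<rho> s"
    and mass_pos: "\<And>s i. \<lbrakk>0 \<le> s; ereal s < T\<rbrakk> \<Longrightarrow> 0 < m (X s) i"
    and dir_plane: "\<And>s i. \<lbrakk>0 \<le> s; ereal s < T\<rbrakk> \<Longrightarrow> P (X s) i \<in> grassmannian d"
    and V: "\<And>s. V s = \<lparr>mass = m (X s), pos = (\<lambda>i. X s $ i), dir = P (X s)\<rparr>"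
    and denom_pos: "\<And>s i. \<lbrakk>0 \<le> s; ereal s < T\<rbrakk> \<Longrightarrow> 0 < curv_denom \<xi> \<epsilon> (V s) i"
    and init: "X 0 = X0"
    and flow: "\<And>s i. \<lbrakk>0 \<le> s; ereal s < T\<rbrakk> \<Longrightarrow>
      ((\<lambda>r. X r $ i) has_vector_derivative approx_curv d \<rho> \<xi> \<kappa> \<epsilon> (V s) i)
        (at s within {r. 0 \<le> r \<and> ereal r < T})"
    and t: "0 \<le> t" "ereal t < T"
    and c_integrable: "set_integrable lebesgue {0..t} (\<lambda>s. contraction_rate \<kappa> \<epsilon> z (V s))"
  shows "cloud_radius z (\<lambda>i. X t $ i) \<le>
    sqrt ((cloud_radius z (\<lambda>i. X0 $ i))\<^sup>2
      - 2 * real d * (LINT s:{0..t}|lebesgue. contraction_rate \<kappa> \<epsilon> z (V s)))"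
proof -
  define c where "c = (\<lambda>s. contraction_rate \<kappa> \<epsilon> z (V s))"
  \<comment> \<open>Unlike the distance, its square is differentiable even when a point passes
    through \<open>z\<close>.\<close>
  define h where "h i s = (norm (X s $ i - z))\<^sup>2" for i s
  define H where "H i s = approx_curv d \<rho> \<xi> \<kappa> \<epsilon> (V s) i" for i s
  have time: "0 \<le> s" "ereal s < T" if "s \<in> {0..t}" for s
    using that t(2) by (auto intro: le_less_trans[of _ "ereal t"])
  have sq: "(cloud_radius z (\<lambda>i. X s $ i))\<^sup>2 = (MAX i. h i s)" for s
    by (simp add: cloud_radius_square h_def)
  have der: "(h i has_real_derivative 2 * (H i s \<bullet> (X s $ i - z))) (at s within {0..t})"
    if "s \<in> {0..t}" for s i
  proof -
    have "((\<lambda>r. X r $ i) has_vector_derivative H i s) (at s within {0..t})"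
      unfolding H_def using time
      by (intro has_vector_derivative_within_subset[OF flow[OF time[OF that]]]) blast
    then have "((\<lambda>r. X r $ i - z) has_derivative (\<lambda>y. y *\<^sub>R H i s)) (at s within {0..t})"
      using has_derivative_diff[OF _ has_derivative_const] unfolding has_vector_derivative_def
      by fastforce
    from has_derivative_inner[OF this this] show ?thesis
      unfolding h_def power2_norm_eq_inner has_field_derivative_def
      by (rule has_derivative_eq_rhs) (simp add: fun_eq_iff inner_commute)
  qed
  have le: "2 * (H i s \<bullet> (X s $ i - z)) \<le> - 2 * real d * c s"
    if "s \<in> {0..t}" "h i s = (MAX i. h i s)" for s i
  proof -
    \<comment> \<open>Maximal squared distance means maximal distance, both quantities being
      nonnegative.\<close>
    have "norm (X s $ i - z) = cloud_radius z (\<lambda>i. X s $ i)"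
      by (rule power2_eq_imp_eq[OF _ norm_ge_zero cloud_radius_nonneg])
        (use that(2) in \<open>simp only: sq h_def\<close>)
    then have "H i s \<bullet> (pos (V s) i - z) \<le> - real d * c s"
      unfolding H_def c_def
      using mass_pos[OF time[OF that(1)]] dir_plane[OF time[OF that(1)]]
        denom_pos[OF time[OF that(1)]]
      by (intro approx_curv_inner_le[OF eps profiles rho_xi])
        (auto simp: V grassmannian_def less_imp_le)
    then show ?thesis
      by (simp add: V)
  qed
  \<comment> \<open>Lebesgue integrability passes to the gauge integral with the same value, which
    is the form needed for the comparison.\<close>
  have c: "c integrable_on {0..t}" "(LINT s:{0..t}|lebesgue. c s) = integral {0..t} c"
    using set_lebesgue_integral_eq_integral[OF c_integrable] by (simp_all add: c_def)
  have "(MAX i. h i t) - (MAX i. h i 0) \<le> integral {0..t} (\<lambda>s. - 2 * real d * c s)"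
  proof (rule increment_le_integral[OF t(1)])
    show "(\<lambda>s. - 2 * real d * c s) integrable_on {0..t}"
      using c(1) by (rule integrable_on_mult_right)
  next
    fix s e :: real
    assume s: "s \<in> {0..t}" and "0 < e"
    show "\<exists>\<delta>>0. \<forall>u\<in>{0..s}. \<forall>v\<in>{s..t}. s - u < \<delta> \<longrightarrow> v - s < \<delta> \<longrightarrow>
        (MAX i. h i v) - (MAX i. h i u) \<le> (- 2 * real d * c s + e) * (v - u)"
      by (rule Max_increment_le[OF s \<open>0 < e\<close> der[OF s] le[OF s]])
  qed
  then have "(cloud_radius z (\<lambda>i. X t $ i))\<^sup>2 \<le>
      (cloud_radius z (\<lambda>i. X0 $ i))\<^sup>2 - 2 * real d * (LINT s:{0..t}|lebesgue. c s)"
    unfolding init[symmetric] sq c(2) integral_mult_right by linarith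
  \<comment> \<open>The expression under the root dominates a square, so it is automatically
    nonnegative.\<close>
  then show ?thesis
    unfolding c_def by (rule real_le_rsqrt)
qed

end
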